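(* In the setting of the context (plant $f,g$ with steady-state maps $s,h$, cost $\Phi$), assume that conditions (a)--(d) listed in the context hold, and let $$\mu_1=\frac{\mu_3}{2d_3},\quad \theta_1=\frac{\ell_f^2\zeta_3^2}{2\mu_3},\quad \theta_2=\frac{\ell_g^2\ell_{\Phi_y}^2}{2(\mu_\Phi-\ell_{\Phi_u})c_3},\quad \mu_2=\frac{\mu_\Phi-\ell_{\Phi_u}}{2}.$$ If $$\mu_\Phi>\ell_{\Phi_u}+\sqrt{\frac{\ell_g^2\,\ell_{\Phi_y}^2\,d_3\,\zeta_3^2\,\ell_f^2}{c_3\,\mu_3^2}},$$ then there exists $\xi>0$ such that $-\mu_1+\xi\theta_1<0$ and $\theta_2-\xi\mu_2<0$.
   Context: Plant: $\dot x=f(x,u)$, $y=g(x)$, with $x\in\mathbb{R}^n$, $u\in\mathbb{R}^m$, $y\in\mathbb{R}^p$. Plant standing assumption: $f:\mathbb{R}^n\times\mathbb{R}^m\to\mathbb{R}^n$ and $g:\mathbb{R}^n\to\mathbb{R}^p$ are locally Lipschitz. For any constant input $u(t)=u\in\mathbb{R}^m$ the plant is globally asymptotically stable; hence there are a unique steady-state map $s:\mathbb{R}^m\to\mathbb{R}^n$ and a steady-state output map $h:\mathbb{R}^m\to\mathbb{R}^p$ with $f(s(u),u)=0$ and $h(u):=g(s(u))$ for all $u$. Furthermore, $h$ is continuously differentiable with locally Lipschitz Jacobian $\nabla h:\mathbb{R}^m\to\mathbb{R}^{p\times m}$. Cost standing assumption: $\Phi:\mathbb{R}^m\times\mathbb{R}^p\to\mathbb{R}$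 is continuously differentiable with locally Lipschitz gradient, and $\min_{u,y}\Phi(u,y)$ s.t. $y=h(u)$ admits a solution. Notation: $\tilde H(u):=\begin{bmatrix} I_m & \nabla h(u)^\top\end{bmatrix}$, so $\tilde H(u)\nabla\Phi(u,y)=\nabla_u\Phi(u,y)+\nabla h(u)^\top\nabla_y\Phi(u,y)$. $\|\cdot\|$ is the Euclidean norm. Conditions (with Lipschitz constants $\ell_f,\ell_g,\ell_{\Phi_y},\ell_{\Phi_u}\ge0$ and $\mu_\Phi>0$): (a) $f(x,u)$ is $\ell_f$-Lipschitz in $u$ for any fixed $x\in\mathbb{R}^n$; $g$ is $\ell_g$-Lipschitz continuous. (b) There exist constants $c_3,d_3,\mu_3,\zeta_3>0$ and a function $W:\mathbb{R}^n\times\mathbb{R}^m\to\mathbb{R}$, differentiable in its first argument, such that for any $u\in\mathbb{R}^m$ and $x\in\mathbb{R}^n$: $c_3\|x-s(u)\|^2\le W(x,u)\le d_3\|x-s(u)\|^2$; $\nabla_xW(x,u)^\top f(x,u)\le-\mu_3\|x-s(u)\|^2$; $\|\nabla_xW(x,u)\|\le\zeta_3\|x-s(u)\|$. (c) $\Phi(u,y)$ is $\mu_\Phi$-strongly convex in $u$ for any fixed $y\in\mathbb{R}^p$; the map $\tilde H(u)\nabla\Phi(u,y)$ is $\ell_{\Phi_y}$-Lipschitz continuous in $y$ for any fixed $u\in\mathbb{R}^m$. (d) The map $\nabla h(u)^\top\nabla_y\Phi(u,y)$ is $\ell_{\Phi_u}$-Lipschitz continuous in $u$ for any fixed $y\in\mathbb{R}^p$,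 and $\mu_\Phi>\ell_{\Phi_u}$. *)

theory Defs
  imports "HOL-Analysis.Analysis"
begin

definition locally_lipschitz :: "('a::metric_space \<Rightarrow> 'b::metric_space) \<Rightarrow> bool" where
  "locally_lipschitz F \<longleftrightarrow> (\<forall>x. \<exists>r>0. \<exists>L. L-lipschitz_on (cball x r) F)"

text \<open>Meaningful only where the function is differentiable; on a pair type the gradient is the
  pair of the two partial gradients.\<close>

definition gradient :: "('a::real_inner \<Rightarrow> real) \<Rightarrow> 'a \<Rightarrow> 'a" where
  "gradient F x = (THE D. GDERIV F x :> D)"

definition strongly_convex :: "real \<Rightarrow> ('a::real_normed_vector \<Rightarrow> real) \<Rightarrow> bool" where
  "strongly_convex \<mu> F \<longleftrightarrow>
    (\<forall>x y. \<forall>t\<in>{0..1}. F (t *\<^sub>R x + (1 - t) *\<^sub>R y)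
       \<le> t * F x + (1 - t) * F y - \<mu> / 2 * t * (1 - t) * (norm (x - y))\<^sup>2)"

lemma gradient_works:
  fixes F :: "'a::euclidean_space \<Rightarrow> real"
  assumes "F differentiable (at x)"
  shows "GDERIV F x :> gradient F x"
proof -
  obtain F' where F': "(F has_derivative F') (at x)"
    using assms by (auto simp: differentiable_def)
  have lin: "linear F'" using F' by (rule has_derivative_linear)
  have "F' = (\<lambda>v. v \<bullet> (\<Sum>b\<in>Basis. F' b *\<^sub>R b))"
  proof
    fix v
    have "F' v = F' (\<Sum>b\<in>Basis. (v \<bullet> b) *\<^sub>R b)" by (simp add: euclidean_representation)
    also have "\<dots> = (\<Sum>b\<in>Basis. (v \<bullet> b) * F' b)"
      using lin by (simp add: linear_sum linear_cmul)
    finally show "F' v = v \<bullet> (\<Sum>b\<in>Basis. F' b *\<^sub>R b)"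
      by (simp add: inner_sum_right mult.commute)
  qed
  then have ex: "GDERIV F x :> (\<Sum>b\<in>Basis. F' b *\<^sub>R b)"
    using F' by (simp add: gderiv_def)
  moreover have "D = D'" if "GDERIV F x :> D" "GDERIV F x :> D'" for D D'
  proof -
    have "(\<lambda>v. v \<bullet> D) = (\<lambda>v. v \<bullet> D')"
      using that has_derivative_unique unfolding gderiv_def by blast
    then show ?thesis by (metis vector_eq_ldot)
  qed
  ultimately show ?thesis unfolding gradient_def by (metis theI)
qed

lemma gradient_eqI:
  fixes F :: "'a::euclidean_space \<Rightarrow> real"
  assumes "GDERIV F x :> D"
  shows "gradient F x = D"
proof -
  have "F differentiable (at x)"
    using assms by (auto simp: gderiv_def differentiable_def)
  then have "(\<lambda>v. v \<bullet> gradient F x) = (\<lambda>v. v \<bullet> D)"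
    using gradient_works assms has_derivative_unique unfolding gderiv_def by blast
  then show ?thesis by (metis vector_eq_ldot)
qed

definition forward_solution :: "('a::real_normed_vector \<Rightarrow> 'a) \<Rightarrow> (real \<Rightarrow> 'a) \<Rightarrow> bool" where
  "forward_solution F x \<longleftrightarrow>
    (\<forall>t\<ge>0. (x has_vector_derivative F (x t)) (at t within {0..}))"

text \<open>Global existence of solutions is part of the notion: otherwise stability and attractivity,
  which quantify over solutions on the whole half-line, could hold vacuously.\<close>

definition gas_equilibrium :: "('a::real_normed_vector \<Rightarrow> 'a) \<Rightarrow> 'a \<Rightarrow> bool" where
  "gas_equilibrium F e \<longleftrightarrow>
    F e = 0 \<and>
    (\<forall>x0. \<exists>x. forward_solution F x \<and> x 0 = x0) \<and>
    (\<forall>\<epsilon>>0. \<exists>\<delta>>0. \<forall>x. forward_solution F x \<and> norm (x 0 - e) < \<delta> \<longrightarrow>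
       (\<forall>t\<ge>0. norm (x t - e) < \<epsilon>)) \<and>
    (\<forall>x. forward_solution F x \<longrightarrow> (x \<longlongrightarrow> e) at_top)"

definition globally_asymptotically_stable :: "('a::real_normed_vector \<Rightarrow> 'a) \<Rightarrow> bool" where
  "globally_asymptotically_stable F \<longleftrightarrow> (\<exists>e. gas_equilibrium F e)"

lemma gas_equilibrium_unique_zero:
  assumes "gas_equilibrium F e" "F z = 0"
  shows "z = e"
proof -
  have "forward_solution F (\<lambda>t. z)"
    using assms(2) by (simp add: forward_solution_def)
  then have "((\<lambda>t::real. z) \<longlongrightarrow> e) at_top"
    using assms(1) by (auto simp: gas_equilibrium_def)
  then show ?thesis by (simp add: tendsto_const_iff)
qed

lemma globally_asymptotically_stable_unique_zero:
  "globally_asymptotically_stable F \<Longrightarrow> \<exists>!z. F z = 0"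
  unfolding globally_asymptotically_stable_def
  by (metis gas_equilibrium_def gas_equilibrium_unique_zero)

text \<open>The block matrix \<open>[I, (\<nabla>h u)\<^sup>T]\<close>, acting on a vector split into its input and output
  components.\<close>

definition H_tilde ::
  "(real^'m \<Rightarrow> real^'p) \<Rightarrow> real^'m \<Rightarrow> (real^'m) \<times> (real^'p) \<Rightarrow> real^'m" where
  "H_tilde h u z = fst z + transpose (jacobian h (at u)) *v snd z"

definition grad_u :: "('a::real_inner \<times> 'b \<Rightarrow> real) \<Rightarrow> 'a \<Rightarrow> 'b \<Rightarrow> 'a" where
  "grad_u \<Phi> u y = gradient (\<lambda>v. \<Phi> (v, y)) u"

definition grad_y :: "('a \<times> 'b::real_inner \<Rightarrow> real) \<Rightarrow> 'a \<Rightarrow> 'b \<Rightarrow> 'b" where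
  "grad_y \<Phi> u y = gradient (\<lambda>w. \<Phi> (u, w)) y"

lemma gradient_Pair:
  fixes \<Phi> :: "'a::euclidean_space \<times> 'b::euclidean_space \<Rightarrow> real"
  assumes "\<Phi> differentiable (at (u, y))"
  shows "gradient \<Phi> (u, y) = (grad_u \<Phi> u y, grad_y \<Phi> u y)"
proof -
  have d: "(\<Phi> has_derivative (\<lambda>v. v \<bullet> gradient \<Phi> (u, y))) (at (u, y))"
    using gradient_works[OF assms] by (simp add: gderiv_def)
  have 1: "((\<lambda>v. (v, y)) has_derivative (\<lambda>v. (v, 0))) (at u)"
    by (intro has_derivative_Pair has_derivative_ident has_derivative_const)
  have 2: "((\<lambda>w. (u, w)) has_derivative (\<lambda>w. (0, w))) (at y)"
    by (intro has_derivative_Pair has_derivative_ident has_derivative_const)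
  have "grad_u \<Phi> u y = fst (gradient \<Phi> (u, y))"
    unfolding grad_u_def
    using has_derivative_compose[OF 1 d]
    by (intro gradient_eqI) (simp add: gderiv_def inner_prod_def)
  moreover have "grad_y \<Phi> u y = snd (gradient \<Phi> (u, y))"
    unfolding grad_y_def
    using has_derivative_compose[OF 2 d]
    by (intro gradient_eqI) (simp add: gderiv_def inner_prod_def)
  ultimately show ?thesis by simp
qed

lemma H_tilde_gradient:
  fixes \<Phi> :: "(real^'m) \<times> (real^'p) \<Rightarrow> real"
  assumes "\<Phi> differentiable (at (u, y))"
  shows "H_tilde h u (gradient \<Phi> (u, y))
    = grad_u \<Phi> u y + transpose (jacobian h (at u)) *v grad_y \<Phi> u y"
  by (simp add: H_tilde_def gradient_Pair[OF assms])

end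

theory Submission
  imports Defs
begin

text \<open>The two inequalities ask for a \<open>\<xi>\<close> with \<open>\<theta>\<^sub>2 / \<mu>\<^sub>2 < \<xi> < \<mu>\<^sub>1 / \<theta>\<^sub>1\<close> (no upper bound if
  \<open>\<theta>\<^sub>1 = 0\<close>). Such a \<open>\<xi>\<close> exists as soon as \<open>\<theta>\<^sub>1 * \<theta>\<^sub>2 < \<mu>\<^sub>1 * \<mu>\<^sub>2\<close>; this is
  \<open>small_gain_multiplier\<close>. Write \<open>D = \<mu>\<^sub>\<Phi> - l\<^sub>\<Phi>\<^sub>u\<close>. Since \<open>\<mu>\<^sub>2\<close> is proportional to \<open>D\<close> and \<open>\<theta>\<^sub>2\<close>
  to \<open>1 / D\<close>, the product inequality is a lower bound on \<open>D\<^sup>2\<close>; its square root is exactly the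
  assumed convexity margin.\<close>

text \<open>The mediant \<open>(\<theta>\<^sub>2 + \<mu>\<^sub>1) / (\<mu>\<^sub>2 + \<theta>\<^sub>1)\<close> of the fractions \<open>\<theta>\<^sub>2 / \<mu>\<^sub>2\<close> and \<open>\<mu>\<^sub>1 / \<theta>\<^sub>1\<close>
  lies strictly between them, and it remains a valid multiplier if \<open>\<theta>\<^sub>1 = 0\<close>; this avoids a
  case distinction.\<close>

lemma small_gain_multiplier:
  fixes \<mu>\<^sub>1 \<mu>\<^sub>2 \<theta>\<^sub>1 \<theta>\<^sub>2 :: "'a::linordered_field"
  assumes "\<mu>\<^sub>1 > 0" "\<mu>\<^sub>2 > 0" "\<theta>\<^sub>1 \<ge> 0" "\<theta>\<^sub>2 \<ge> 0"
    and "\<theta>\<^sub>1 * \<theta>\<^sub>2 < \<mu>\<^sub>1 * \<mu>\<^sub>2"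
  shows "\<exists>\<xi>>0. - \<mu>\<^sub>1 + \<xi> * \<theta>\<^sub>1 < 0 \<and> \<theta>\<^sub>2 - \<xi> * \<mu>\<^sub>2 < 0"
proof -
  define \<xi> where "\<xi> = (\<theta>\<^sub>2 + \<mu>\<^sub>1) / (\<mu>\<^sub>2 + \<theta>\<^sub>1)"
  have den: "\<mu>\<^sub>2 + \<theta>\<^sub>1 > 0"
    using assms by (simp add: add_pos_nonneg)
  have "\<xi> > 0"
    using assms den by (simp add: \<xi>_def add_nonneg_pos)
  moreover have "\<xi> * \<theta>\<^sub>1 < \<mu>\<^sub>1"
    using assms(5) den by (simp add: \<xi>_def pos_divide_less_eq algebra_simps)
  moreover have "\<theta>\<^sub>2 < \<xi> * \<mu>\<^sub>2"
    using assms(5) den by (simp add: \<xi>_def pos_less_divide_eq algebra_simps)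
  ultimately show ?thesis
    by (intro exI[of _ \<xi>]) simp
qed

theorem corollary2:
  fixes f :: "(real^'n) \<times> (real^'m) \<Rightarrow> real^'n"
    and g :: "real^'n \<Rightarrow> real^'p"
    and s :: "real^'m \<Rightarrow> real^'n"
    and h :: "real^'m \<Rightarrow> real^'p"
    and \<Phi> :: "(real^'m) \<times> (real^'p) \<Rightarrow> real"
    and W :: "(real^'n) \<times> (real^'m) \<Rightarrow> real"
    and l\<^sub>f l\<^sub>g l\<^sub>\<Phi>\<^sub>y l\<^sub>\<Phi>\<^sub>u \<mu>\<^sub>\<Phi> c\<^sub>3 d\<^sub>3 \<mu>\<^sub>3 \<zeta>\<^sub>3 :: real
    and \<mu>\<^sub>1 \<theta>\<^sub>1 \<theta>\<^sub>2 \<mu>\<^sub>2 :: real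
  assumes plant_lipschitz: "locally_lipschitz f" "locally_lipschitz g"
    and plant_gas: "\<forall>u. globally_asymptotically_stable (\<lambda>x. f (x, u))"
    and steady_state: "\<forall>u. f (s u, u) = 0" "\<forall>u. h u = g (s u)"
    and h_C1: "\<forall>u. h differentiable (at u)"
      "continuous_on UNIV (\<lambda>u. jacobian h (at u))"
      "locally_lipschitz (\<lambda>u. jacobian h (at u))"
    and cost_C1: "\<forall>z. \<Phi> differentiable (at z)"
      "continuous_on UNIV (gradient \<Phi>)"
      "locally_lipschitz (gradient \<Phi>)"
    and cost_solvable:
      "\<exists>u\<^sub>0 y\<^sub>0. y\<^sub>0 = h u\<^sub>0 \<and> (\<forall>u y. y = h u \<longrightarrow> \<Phi> (u\<^sub>0, y\<^sub>0) \<le> \<Phi> (u, y))"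
    and constants: "l\<^sub>f \<ge> 0" "l\<^sub>g \<ge> 0" "l\<^sub>\<Phi>\<^sub>y \<ge> 0" "l\<^sub>\<Phi>\<^sub>u \<ge> 0" "\<mu>\<^sub>\<Phi> > 0"
    and cond_a: "\<forall>x. l\<^sub>f-lipschitz_on UNIV (\<lambda>u. f (x, u))"
      "l\<^sub>g-lipschitz_on UNIV g"
    and cond_b_constants: "c\<^sub>3 > 0" "d\<^sub>3 > 0" "\<mu>\<^sub>3 > 0" "\<zeta>\<^sub>3 > 0"
    and cond_b: "\<forall>x u. (\<lambda>z. W (z, u)) differentiable (at x)"
      "\<forall>x u. c\<^sub>3 * (norm (x - s u))\<^sup>2 \<le> W (x, u) \<and> W (x, u) \<le> d\<^sub>3 * (norm (x - s u))\<^sup>2"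
      "\<forall>x u. gradient (\<lambda>z. W (z, u)) x \<bullet> f (x, u) \<le> - \<mu>\<^sub>3 * (norm (x - s u))\<^sup>2"
      "\<forall>x u. norm (gradient (\<lambda>z. W (z, u)) x) \<le> \<zeta>\<^sub>3 * norm (x - s u)"
    and cond_c: "\<forall>y. strongly_convex \<mu>\<^sub>\<Phi> (\<lambda>u. \<Phi> (u, y))"
      "\<forall>u. l\<^sub>\<Phi>\<^sub>y-lipschitz_on UNIV (\<lambda>y. H_tilde h u (gradient \<Phi> (u, y)))"
    and cond_d:
      "\<forall>y. l\<^sub>\<Phi>\<^sub>u-lipschitz_on UNIV (\<lambda>u. transpose (jacobian h (at u)) *v grad_y \<Phi> u y)"
      "\<mu>\<^sub>\<Phi> > l\<^sub>\<Phi>\<^sub>u"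
    and mu1: "\<mu>\<^sub>1 = \<mu>\<^sub>3 / (2 * d\<^sub>3)"
    and theta1: "\<theta>\<^sub>1 = l\<^sub>f\<^sup>2 * \<zeta>\<^sub>3\<^sup>2 / (2 * \<mu>\<^sub>3)"
    and theta2: "\<theta>\<^sub>2 = l\<^sub>g\<^sup>2 * l\<^sub>\<Phi>\<^sub>y\<^sup>2 / (2 * (\<mu>\<^sub>\<Phi> - l\<^sub>\<Phi>\<^sub>u) * c\<^sub>3)"
    and mu2: "\<mu>\<^sub>2 = (\<mu>\<^sub>\<Phi> - l\<^sub>\<Phi>\<^sub>u) / 2"
    and convexity_margin: "\<mu>\<^sub>\<Phi> > l\<^sub>\<Phi>\<^sub>u + sqrt (l\<^sub>g\<^sup>2 * l\<^sub>\<Phi>\<^sub>y\<^sup>2 * d\<^sub>3 * \<zeta>\<^sub>3\<^sup>2 * l\<^sub>f\<^sup>2 / (c\<^sub>3 * \<mu>\<^sub>3\<^sup>2))"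
  shows "\<exists>\<xi>>0. - \<mu>\<^sub>1 + \<xi> * \<theta>\<^sub>1 < 0 \<and> \<theta>\<^sub>2 - \<xi> * \<mu>\<^sub>2 < 0"
proof -
  define D where "D = \<mu>\<^sub>\<Phi> - l\<^sub>\<Phi>\<^sub>u"
  define K where "K = l\<^sub>g\<^sup>2 * l\<^sub>\<Phi>\<^sub>y\<^sup>2 * d\<^sub>3 * \<zeta>\<^sub>3\<^sup>2 * l\<^sub>f\<^sup>2 / (c\<^sub>3 * \<mu>\<^sub>3\<^sup>2)"
  have D: "D > 0"
    using cond_d(2) by (simp add: D_def)
  have "sqrt K < D"
    using convexity_margin by (simp add: D_def K_def)
  then have "K < D\<^sup>2"
    using D real_le_rsqrt[of D K] by (auto simp: not_le[symmetric])
  (* The common factor that turns K and D^2 into the two products is \<mu>\<^sub>3 / (4 * d\<^sub>3 * D). *)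
  have "\<theta>\<^sub>1 * \<theta>\<^sub>2 = \<mu>\<^sub>3 / (4 * d\<^sub>3 * D) * K"
    using cond_b_constants D
    by (simp add: theta1 theta2 K_def D_def[symmetric] field_simps power2_eq_square)
  also have "\<dots> < \<mu>\<^sub>3 / (4 * d\<^sub>3 * D) * D\<^sup>2"
    using \<open>K < D\<^sup>2\<close> cond_b_constants D by (intro mult_strict_left_mono) simp_all
  also have "\<dots> = \<mu>\<^sub>1 * \<mu>\<^sub>2"
    using cond_b_constants D
    by (simp add: mu1 mu2 D_def[symmetric] field_simps power2_eq_square)
  finally have "\<theta>\<^sub>1 * \<theta>\<^sub>2 < \<mu>\<^sub>1 * \<mu>\<^sub>2" .
  moreover have "\<mu>\<^sub>1 > 0" "\<mu>\<^sub>2 > 0" "\<theta>\<^sub>1 \<ge> 0" "\<theta>\<^sub>2 \<ge> 0"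
    using cond_b_constants D
    by (simp_all add: mu1 mu2 theta1 theta2 D_def[symmetric])
  ultimately show ?thesis
    by (intro small_gain_multiplier)
qed

end
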